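(* Let $F:A\times B\to Z$ be a single-valued mapping and let $(\bar x,\bar y)\in A\times B$. (i) If $F$ is partially Gâteaux differentiable with respect to the first variable at $(\bar x,\bar y)$, then $$(\bar x,\bar y)\in E_1(F,A,B)\ \Longrightarrow\ (\bar x,\bar y)\in\partial_1^CF.$$ (ii) If $F$ is partially Gâteaux differentiable with respect to the second variable at $(\bar x,\bar y)$, then $$(\bar x,\bar y)\in E_2(F,A,B)\ \Longrightarrow\ (\bar x,\bar y)\in\partial_2^CF.$$
   Context: $(X,\|\cdot\|_X)$, $(Y,\|\cdot\|_Y)$ are Banach spaces and $(Z,\|\cdot\|_Z,\preccurlyeq_M)$ is a partially ordered Banach space whose order is generated by a nonempty closed convex pointed cone $M\subseteq Z$ ($z_1\preccurlyeq_Mz_2$ iff $z_2-z_1\in M$); null elements are $\theta_X,\theta_Y,\theta_Z$. $A\subseteq X$ and $B\subseteq Y$ are nonempty convex open subsets; $t$ is a real variable. $F$ is partially Gâteaux differentiable with respect to the first variable at $(\bar x,\bar y)$ if for every $v\in X\setminus\{\theta_X\}$ the limit $\partial_1F(\bar x,\bar y)(v):=\lim_{t\to0}\frac{F(\bar x+tv,\bar y)-F(\bar x,\bar y)}{t}$ exists in $Z$; with respect to the second variable if for every $u\in Y\setminus\{\theta_Y\}$ the limit $\partial_2F(\bar x,\bar y)(u):=\lim_{t\to0}\frac{F(\bar x,\bar y+tu)-F(\bar x,\bar y)}{t}$ exists in $Z$. $\partial_1^CF$ is the set of $(\bar x,\bar y)\in A\times B$ at which $F$ is partially Gâteaux differentiable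 with respect to the first variable and $\partial_1F(\bar x,\bar y)(v)=\theta_Z$ for all $v\in X\setminus\{\theta_X\}$; $\partial_2^CF$ is defined in the same way with $\partial_2F(\bar x,\bar y)(u)=\theta_Z$ for all $u\in Y\setminus\{\theta_Y\}$. $E_1(F,A,B)$ is the set of $(\bar x,\bar y)\in A\times B$ such that either $F(\bar x,\bar y)\preccurlyeq_MF(x,\bar y)$ for every $x\in A$, or $F(x,\bar y)\preccurlyeq_MF(\bar x,\bar y)$ for every $x\in A$. $E_2(F,A,B)$ is the set of $(\bar x,\bar y)\in A\times B$ such that either $F(\bar x,\bar y)\preccurlyeq_MF(\bar x,y)$ for every $y\in B$, or $F(\bar x,y)\preccurlyeq_MF(\bar x,\bar y)$ for every $y\in B$. *)

theory Defs
  imports "HOL-Analysis.Analysis"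
begin

text \<open>
  A mapping \<open>F : A \<times> B \<rightarrow> Z\<close> is given by a total function on \<open>X \<times> Y\<close>; its values outside
  \<open>A \<times> B\<close> are never relevant: the extremal sets only inspect \<open>A \<times> B\<close>, and, since \<open>A\<close> and \<open>B\<close>
  are open, the limits below at a point of \<open>A \<times> B\<close> only depend on the values on \<open>A \<times> B\<close>.
\<close>

definition cone_le :: "'z::real_vector set \<Rightarrow> 'z \<Rightarrow> 'z \<Rightarrow> bool" where
  "cone_le M z1 z2 \<longleftrightarrow> z2 - z1 \<in> M"

text \<open>The library's \<^const>\<open>cone\<close> means closed under scaling by all \<open>c \<ge> 0\<close>;
  pointed means that \<open>M\<close> contains no line through the origin.\<close>

definition ordering_cone :: "'z::real_normed_vector set \<Rightarrow> bool" where
  "ordering_cone M \<longleftrightarrow>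
     M \<noteq> {} \<and> closed M \<and> convex M \<and> cone M \<and> M \<inter> uminus ` M = {0}"

definition diff_quot1 ::
  "('x::real_normed_vector \<times> 'y::real_normed_vector \<Rightarrow> 'z::real_normed_vector)
     \<Rightarrow> 'x \<times> 'y \<Rightarrow> 'x \<Rightarrow> real \<Rightarrow> 'z" where
  "diff_quot1 F = (\<lambda>(x, y) v t. (F (x + t *\<^sub>R v, y) - F (x, y)) /\<^sub>R t)"

definition diff_quot2 ::
  "('x::real_normed_vector \<times> 'y::real_normed_vector \<Rightarrow> 'z::real_normed_vector)
     \<Rightarrow> 'x \<times> 'y \<Rightarrow> 'y \<Rightarrow> real \<Rightarrow> 'z" where
  "diff_quot2 F = (\<lambda>(x, y) u t. (F (x, y + t *\<^sub>R u) - F (x, y)) /\<^sub>R t)"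

definition partial_gateaux_differentiable1 ::
  "('x::real_normed_vector \<times> 'y::real_normed_vector \<Rightarrow> 'z::real_normed_vector)
     \<Rightarrow> 'x \<times> 'y \<Rightarrow> bool" where
  "partial_gateaux_differentiable1 F p \<longleftrightarrow>
     (\<forall>v. v \<noteq> 0 \<longrightarrow> (\<exists>l. (diff_quot1 F p v \<longlongrightarrow> l) (at 0)))"

definition partial_gateaux_differentiable2 ::
  "('x::real_normed_vector \<times> 'y::real_normed_vector \<Rightarrow> 'z::real_normed_vector)
     \<Rightarrow> 'x \<times> 'y \<Rightarrow> bool" where
  "partial_gateaux_differentiable2 F p \<longleftrightarrow>
     (\<forall>u. u \<noteq> 0 \<longrightarrow> (\<exists>l. (diff_quot2 F p u \<longlongrightarrow> l) (at 0)))"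

text \<open>The derivatives are meaningful only where the limits exist.\<close>

definition partial_gateaux_deriv1 ::
  "('x::real_normed_vector \<times> 'y::real_normed_vector \<Rightarrow> 'z::real_normed_vector)
     \<Rightarrow> 'x \<times> 'y \<Rightarrow> 'x \<Rightarrow> 'z" where
  "partial_gateaux_deriv1 F p v = Lim (at 0) (diff_quot1 F p v)"

definition partial_gateaux_deriv2 ::
  "('x::real_normed_vector \<times> 'y::real_normed_vector \<Rightarrow> 'z::real_normed_vector)
     \<Rightarrow> 'x \<times> 'y \<Rightarrow> 'y \<Rightarrow> 'z" where
  "partial_gateaux_deriv2 F p u = Lim (at 0) (diff_quot2 F p u)"

definition critical_set1 ::
  "('x::real_normed_vector \<times> 'y::real_normed_vector \<Rightarrow> 'z::real_normed_vector)
     \<Rightarrow> 'x set \<Rightarrow> 'y set \<Rightarrow> ('x \<times> 'y) set" where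
  "critical_set1 F A B = {p \<in> A \<times> B. partial_gateaux_differentiable1 F p \<and>
     (\<forall>v. v \<noteq> 0 \<longrightarrow> partial_gateaux_deriv1 F p v = 0)}"

definition critical_set2 ::
  "('x::real_normed_vector \<times> 'y::real_normed_vector \<Rightarrow> 'z::real_normed_vector)
     \<Rightarrow> 'x set \<Rightarrow> 'y set \<Rightarrow> ('x \<times> 'y) set" where
  "critical_set2 F A B = {p \<in> A \<times> B. partial_gateaux_differentiable2 F p \<and>
     (\<forall>u. u \<noteq> 0 \<longrightarrow> partial_gateaux_deriv2 F p u = 0)}"

definition extremal_set1 ::
  "'z::real_vector set \<Rightarrow> ('x \<times> 'y \<Rightarrow> 'z) \<Rightarrow> 'x set \<Rightarrow> 'y set \<Rightarrow> ('x \<times> 'y) set" where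
  "extremal_set1 M F A B = {(x0, y0) \<in> A \<times> B.
     (\<forall>x\<in>A. cone_le M (F (x0, y0)) (F (x, y0))) \<or>
     (\<forall>x\<in>A. cone_le M (F (x, y0)) (F (x0, y0)))}"

definition extremal_set2 ::
  "'z::real_vector set \<Rightarrow> ('x \<times> 'y \<Rightarrow> 'z) \<Rightarrow> 'x set \<Rightarrow> 'y set \<Rightarrow> ('x \<times> 'y) set" where
  "extremal_set2 M F A B = {(x0, y0) \<in> A \<times> B.
     (\<forall>y\<in>B. cone_le M (F (x0, y0)) (F (x0, y))) \<or>
     (\<forall>y\<in>B. cone_le M (F (x0, y)) (F (x0, y0)))}"

end

theory Submission
  imports Defs
begin

text \<open>
  This is Fermat's rule for stationary points, with the cone order in place of the order of the
  reals. Freezing one variable leaves a function \<open>g\<close> of the other. If \<open>g\<close> is minimal at \<open>a\<close>,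
  every increment \<open>g (a + t v) - g a\<close> with small \<open>t\<close> lies in the cone \<open>M\<close>, so the difference
  quotient lies in \<open>M\<close> for \<open>t > 0\<close> and in \<open>-M\<close> for \<open>t < 0\<close>. As \<open>M\<close> is closed, the two-sided limit
  lies in \<open>M \<inter> -M\<close>, and this intersection is \<open>{0}\<close> because \<open>M\<close> is pointed. The maximal case
  is the minimal case for \<open>-g\<close>. Both halves of the theorem are instances of
  \<open>cone_extremum_directional_derivative_zero\<close>.
\<close>

text \<open>
  The two one-sided limits are taken separately: each confines the common limit \<open>l\<close> to one of
  the closed sets \<open>M\<close> and \<open>-M\<close>.
\<close>

lemma cone_minimum_directional_derivative_zero:
  fixes g :: "'a::real_normed_vector \<Rightarrow> 'b::real_normed_vector"
  assumes M: "ordering_cone M" and "open S" "a \<in> S"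
    and min: "\<And>x. x \<in> S \<Longrightarrow> cone_le M (g a) (g x)"
    and lim: "((\<lambda>t. (g (a + t *\<^sub>R v) - g a) /\<^sub>R t) \<longlongrightarrow> l) (at 0)"
  shows "l = 0"
proof -
  have "closed M" and cone: "\<And>c x. 0 \<le> c \<Longrightarrow> x \<in> M \<Longrightarrow> c *\<^sub>R x \<in> M"
    and pointed: "M \<inter> uminus ` M = {0}"
    using M by (auto simp: ordering_cone_def cone_def)
  have "((\<lambda>t. a + t *\<^sub>R v) \<longlongrightarrow> a + 0 *\<^sub>R v) (at (0::real))"
    by (intro tendsto_intros)
  then have "eventually (\<lambda>t. a + t *\<^sub>R v \<in> S) (at (0::real))"
    using \<open>open S\<close> \<open>a \<in> S\<close> by (auto dest: topological_tendstoD)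
  then have incr: "eventually (\<lambda>t. g (a + t *\<^sub>R v) - g a \<in> M) (at (0::real))"
    by eventually_elim (use min in \<open>simp add: cone_le_def\<close>)
  have "l \<in> M"
  proof (rule Lim_in_closed_set[OF \<open>closed M\<close>])
    show "((\<lambda>t. (g (a + t *\<^sub>R v) - g a) /\<^sub>R t) \<longlongrightarrow> l) (at_right 0)"
      using lim by (simp add: filterlim_at_split)
    have "eventually (\<lambda>t. g (a + t *\<^sub>R v) - g a \<in> M) (at_right (0::real))"
      using incr by (simp add: eventually_at_split)
    then show "eventually (\<lambda>t. (g (a + t *\<^sub>R v) - g a) /\<^sub>R t \<in> M) (at_right 0)"
      using eventually_at_right_less[of "0::real"]
      by eventually_elim (simp add: cone)
  qed simp
  moreover have "- l \<in> M"
  proof (rule Lim_in_closed_set[OF \<open>closed M\<close>])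
    show "((\<lambda>t. - ((g (a + t *\<^sub>R v) - g a) /\<^sub>R t)) \<longlongrightarrow> - l) (at_left 0)"
      using lim by (intro tendsto_minus) (simp add: filterlim_at_split)
    have "eventually (\<lambda>t. g (a + t *\<^sub>R v) - g a \<in> M) (at_left (0::real))"
      using incr by (simp add: eventually_at_split)
    moreover have "eventually (\<lambda>t. t < 0) (at_left (0::real))"
      by (simp add: eventually_at_filter)
    ultimately show "eventually (\<lambda>t. - ((g (a + t *\<^sub>R v) - g a) /\<^sub>R t) \<in> M) (at_left 0)"
    proof eventually_elim
      case (elim t)
      then show ?case
        using cone[of "- inverse t" "g (a + t *\<^sub>R v) - g a"] by simp
    qed
  qed simp
  ultimately have "l \<in> M \<inter> uminus ` M"
    by (auto intro: image_eqI[of _ _ "- l"])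
  then show ?thesis
    using pointed by simp
qed

lemma cone_extremum_directional_derivative_zero:
  fixes g :: "'a::real_normed_vector \<Rightarrow> 'b::real_normed_vector"
  assumes M: "ordering_cone M" and S: "open S" "a \<in> S"
    and ext: "(\<forall>x\<in>S. cone_le M (g a) (g x)) \<or> (\<forall>x\<in>S. cone_le M (g x) (g a))"
    and lim: "((\<lambda>t. (g (a + t *\<^sub>R v) - g a) /\<^sub>R t) \<longlongrightarrow> l) (at 0)"
  shows "l = 0"
  using ext
proof
  assume "\<forall>x\<in>S. cone_le M (g a) (g x)"
  then show ?thesis
    using cone_minimum_directional_derivative_zero[OF M S _ lim] by blast
next
  assume max: "\<forall>x\<in>S. cone_le M (g x) (g a)"
  have "((\<lambda>t. (- g (a + t *\<^sub>R v) - - g a) /\<^sub>R t) \<longlongrightarrow> - l) (at 0)"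
    using tendsto_minus[OF lim] by (simp flip: scaleR_minus_right)
  then have "- l = 0"
    using max
    by (intro cone_minimum_directional_derivative_zero[OF M S, where g = "\<lambda>x. - g x"])
      (auto simp: cone_le_def)
  then show ?thesis
    by simp
qed

theorem theorem4p3:
  fixes F :: "'x::banach \<times> 'y::banach \<Rightarrow> 'z::banach"
    and M :: "'z set" and A :: "'x set" and B :: "'y set"
    and xbar :: 'x and ybar :: 'y
  assumes "ordering_cone M"
    and "A \<noteq> {}" and "convex A" and "open A"
    and "B \<noteq> {}" and "convex B" and "open B"
    and "(xbar, ybar) \<in> A \<times> B"
  shows "(partial_gateaux_differentiable1 F (xbar, ybar) \<longrightarrow>
            (xbar, ybar) \<in> extremal_set1 M F A B \<longrightarrow> (xbar, ybar) \<in> critical_set1 F A B) \<and>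
         (partial_gateaux_differentiable2 F (xbar, ybar) \<longrightarrow>
            (xbar, ybar) \<in> extremal_set2 M F A B \<longrightarrow> (xbar, ybar) \<in> critical_set2 F A B)"
proof (intro conjI impI)
  assume diff: "partial_gateaux_differentiable1 F (xbar, ybar)"
    and ext: "(xbar, ybar) \<in> extremal_set1 M F A B"
  have "partial_gateaux_deriv1 F (xbar, ybar) v = 0" if nonzero: "v \<noteq> 0" for v
  proof -
    obtain l where l: "(diff_quot1 F (xbar, ybar) v \<longlongrightarrow> l) (at 0)"
      using diff nonzero by (auto simp: partial_gateaux_differentiable1_def)
    have "l = 0"
      by (rule cone_extremum_directional_derivative_zero
          [OF \<open>ordering_cone M\<close> \<open>open A\<close>, where a = xbar and g = "\<lambda>x. F (x, ybar)" and v = v])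
        (use ext l in \<open>auto simp: extremal_set1_def diff_quot1_def\<close>)
    then show ?thesis
      using l by (simp add: partial_gateaux_deriv1_def tendsto_Lim)
  qed
  then show "(xbar, ybar) \<in> critical_set1 F A B"
    using diff assms(8) by (simp add: critical_set1_def)
next
  assume diff: "partial_gateaux_differentiable2 F (xbar, ybar)"
    and ext: "(xbar, ybar) \<in> extremal_set2 M F A B"
  have "partial_gateaux_deriv2 F (xbar, ybar) u = 0" if nonzero: "u \<noteq> 0" for u
  proof -
    obtain l where l: "(diff_quot2 F (xbar, ybar) u \<longlongrightarrow> l) (at 0)"
      using diff nonzero by (auto simp: partial_gateaux_differentiable2_def)
    have "l = 0"
      by (rule cone_extremum_directional_derivative_zero
          [OF \<open>ordering_cone M\<close> \<open>open B\<close>, where a = ybar and g = "\<lambda>y. F (xbar, y)" and v = u])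
        (use ext l in \<open>auto simp: extremal_set2_def diff_quot2_def\<close>)
    then show ?thesis
      using l by (simp add: partial_gateaux_deriv2_def tendsto_Lim)
  qed
  then show "(xbar, ybar) \<in> critical_set2 F A B"
    using diff assms(8) by (simp add: critical_set2_def)
qed

end
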